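(* Consider the i-C&CG algorithm (described in the context) applied to the two-stage robust problem $$\upsilon^\star=\min_{x\in\mathcal X}\Big\{c^\top x+\max_{\xi\in\Xi}\ \min_{y\in\mathcal Y(x,\xi)}q^\top y\Big\}$$ under the standing assumptions listed in the context, with termination tolerance $\varepsilon$ and backtracking parameter $\widetilde\varepsilon>0$. If $\widetilde\varepsilon<\varepsilon/(1+\varepsilon)$, then the algorithm terminates in a finite number of iterations.
   Context: Problem. $x\in\mathbb R^n$ are first-stage variables with feasible set $\mathcal X\subseteq\mathbb R^n$; $\Xi\subseteq\mathbb R^l$ is the uncertainty set; $\mathcal Y(x,\xi)=\{y\in\mathbb R^m_+ : Tx+Wy+C\xi\ge h\}$ is the second-stage feasible set (some components of $x$ and $y$ may be required to be integer); $c,q,h,T,W,C$ are known vectors/matrices of compatible sizes. Write $Q(x,\xi)=\min_{y\in\mathcal Y(x,\xi)}q^\top y$. Standing assumptions. (i) $\Xi$ is a nonempty finite set or a polytope. (ii) $\mathcal Y(x,\xi)\neq\emptyset$ for all $x\in\mathcal X,\xi\in\Xi$. (iii) The problem has an optimal solution $x^\star$ with finite optimal value $\upsilon^\star$. (iv) There is $K>0$ with $c^\top x+Q(x,\xi)\ge K$ for all $x\in\mathcal X,\xi\in\Xi$. (v) For each $x\in\mathcal X$ an oracle solves $\max_{\xi\in\Xi}Q(x,\xi)$ exactly, returning an optimal $\xi^\star$, which is an extreme point of $\Xi$ when $\Xi$ is a polytope. i-C&CG algorithm. Parameters: $\varepsilon\in[0,1]$, $\widetilde\varepsilon\in(0,\varepsilon/(1+\varepsilon))$,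 $\varepsilon_{MP}^j\in(0,1)$ for $j\in\mathbb N$, $\alpha\in(0,1)$. Initialize $\overline L\gets0$, $\overline U\gets\infty$, $\mathcal S\gets\emptyset$, $j\gets1$, $\ell\gets0$, with the convention $L^0=0$. Step 1.1. Solve, to within relative optimality gap $\varepsilon_{MP}^j$, the master problem $$\upsilon_j^\star=\min_{x\in\mathcal X,\ \delta\in\mathbb R}\ c^\top x+\delta\quad\text{s.t.}\quad \delta\ge Q(x,\xi)\ \ \forall\xi\in\mathcal S,\qquad c^\top x+\delta\ge\overline L,$$ and record the best feasible solution found, $(x^j,\delta^j)$. Step 1.2. Record a lower bound $L^j\ge\overline L$ on $\upsilon_j^\star$ and the upper bound $U^j=c^\top x^j+\delta^j$ of $\upsilon_j^\star$ (overwriting earlier values with index $j$); the gap requirement means $U^j-L^j\le\varepsilon_{MP}^jU^j$. If $L^j>\overline L$, set $\ell\gets j$. Step 1.3. Set $\overline L\gets U^j$. Step 2. Compute $D^j=\max_{\xi\in\Xi}Q(x^j,\xi)$ with the oracle, obtaining an optimal $\xi^\star$, and set $\overline U\gets\min\{\overline U,\ c^\top x^j+D^j\}$. Step 3. If $(\overline U-L^\ell)/\overline U<\varepsilon$, terminate and return $x^j$. Otherwise: (Exploitation) if $(\overline U-U^j)/\overline U<\widetilde\varepsilon$, set $j\gets\ell$, $\overline L\gets L^\ell$, replace $\varepsilon_{MP}^k$ by $\alpha\varepsilon_{MP}^k$ for all $k\ge\ell$, and go to Step 1 (the set $\mathcal S$ is kept); (Exploration) if $(\overline U-U^j)/\overline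 U\ge\widetilde\varepsilon$, go to Step 4. Step 4. Set $\mathcal S\gets\mathcal S\cup\{\xi^\star\}$, $j\gets j+1$, and go to Step 1. *)

theory Defs
  imports "HOL-Analysis.Analysis"
begin

text \<open>Integrality of first-stage components is part of the arbitrary set \<open>fs_set\<close>;
  \<open>int_comps\<close> is the set of second-stage components that are required to be integer.\<close>

record ('n::finite, 'm::finite, 'l::finite, 'r::finite) two_stage =
  fs_set    :: "(real^'n) set"
  unc_set   :: "(real^'l) set"
  c_vec     :: "real^'n"
  q_vec     :: "real^'m"
  h_vec     :: "real^'r"
  T_mat     :: "real^'n^'r"
  W_mat     :: "real^'m^'r"
  C_mat     :: "real^'l^'r"
  int_comps :: "'m set"

definition second_stage_set ::
  "('n::finite, 'm::finite, 'l::finite, 'r::finite) two_stage \<Rightarrow> real^'n \<Rightarrow> real^'l \<Rightarrow> (real^'m) set" where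
  "second_stage_set P x \<xi> =
     {y. 0 \<le> y \<and> (\<forall>i\<in>int_comps P. y $ i \<in> \<int>) \<and>
         h_vec P \<le> T_mat P *v x + W_mat P *v y + C_mat P *v \<xi>}"

text \<open>Optimal values are extended reals, so an infeasible or unbounded problem has value
  \<open>\<infinity>\<close> or \<open>-\<infinity>\<close> instead of an unspecified real number. Minima are read as infima.\<close>

definition recourse ::
  "('n::finite, 'm::finite, 'l::finite, 'r::finite) two_stage \<Rightarrow> real^'n \<Rightarrow> real^'l \<Rightarrow> ereal" where
  "recourse P x \<xi> = (INF y\<in>second_stage_set P x \<xi>. ereal (q_vec P \<bullet> y))"

definition worst_recourse ::
  "('n::finite, 'm::finite, 'l::finite, 'r::finite) two_stage \<Rightarrow> real^'n \<Rightarrow> ereal" where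
  "worst_recourse P x = (SUP \<xi>\<in>unc_set P. recourse P x \<xi>)"

definition robust_obj ::
  "('n::finite, 'm::finite, 'l::finite, 'r::finite) two_stage \<Rightarrow> real^'n \<Rightarrow> ereal" where
  "robust_obj P x = ereal (c_vec P \<bullet> x) + worst_recourse P x"

definition robust_optimal ::
  "('n::finite, 'm::finite, 'l::finite, 'r::finite) two_stage \<Rightarrow> real^'n \<Rightarrow> ereal \<Rightarrow> bool" where
  "robust_optimal P x v \<longleftrightarrow>
     x \<in> fs_set P \<and> robust_obj P x = v \<and> (\<forall>x'\<in>fs_set P. v \<le> robust_obj P x')"

text \<open>The oracle is a set-valued map: \<open>orc x\<close> contains all answers it may give when called
  at \<open>x\<close>, so repeated calls at the same point need not agree.\<close>

definition exact_oracle ::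
  "('n::finite, 'm::finite, 'l::finite, 'r::finite) two_stage \<Rightarrow> (real^'n \<Rightarrow> (real^'l) set) \<Rightarrow> bool" where
  "exact_oracle P orc \<longleftrightarrow>
     (\<forall>x\<in>fs_set P. orc x \<noteq> {} \<and>
        (\<forall>\<xi>\<in>orc x. \<xi> \<in> unc_set P \<and> recourse P x \<xi> = worst_recourse P x \<and>
           (polytope (unc_set P) \<longrightarrow> \<xi> extreme_point_of unc_set P)))"

definition master_set ::
  "('n::finite, 'm::finite, 'l::finite, 'r::finite) two_stage \<Rightarrow> (real^'l) set \<Rightarrow> real
     \<Rightarrow> ((real^'n) \<times> real) set" where
  "master_set P S lbar =
     {(x, \<delta>). x \<in> fs_set P \<and> (\<forall>\<xi>\<in>S. recourse P x \<xi> \<le> ereal \<delta>) \<and> lbar \<le> c_vec P \<bullet> x + \<delta>}"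

definition master_value ::
  "('n::finite, 'm::finite, 'l::finite, 'r::finite) two_stage \<Rightarrow> (real^'l) set \<Rightarrow> real \<Rightarrow> ereal" where
  "master_value P S lbar = (INF (x, \<delta>)\<in>master_set P S lbar. ereal (c_vec P \<bullet> x + \<delta>))"

text \<open>The variables at the beginning of Step 1: \<open>L_bar\<close>, \<open>U_bar\<close>, the scenario set,
  the index \<open>j\<close>, the index \<open>\<ell>\<close>, and the current values (they get overwritten) of the
  families \<open>L\<^sup>j\<close>, \<open>U\<^sup>j\<close> and of the master tolerances.\<close>

record 'l iccg_state =
  L_bar  :: real
  U_bar  :: ereal
  scen   :: "(real^'l) set"
  idx    :: nat
  ell    :: nat
  L_at   :: "nat \<Rightarrow> real"
  U_at   :: "nat \<Rightarrow> real"
  mp_tol :: "nat \<Rightarrow> real"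

text \<open>Apart from \<open>L\<^sup>0 = 0\<close>, the initial entries of \<open>L_at\<close> and \<open>U_at\<close> are placeholders
  that are never read.\<close>

definition iccg_init :: "(nat \<Rightarrow> real) \<Rightarrow> ('l::finite) iccg_state" where
  "iccg_init tol =
     \<lparr>L_bar = 0, U_bar = \<infinity>, scen = {}, idx = 1, ell = 0,
      L_at = (\<lambda>_. 0), U_at = (\<lambda>_. 0), mp_tol = tol\<rparr>"

text \<open>\<open>solve_steps P orc s x \<xi> t\<close>: Steps 1 and 2, started in \<open>s\<close>, may produce the master
  solution \<open>x\<close> and the oracle answer \<open>\<xi>\<close> and lead to \<open>t\<close>. The master solver is nondeterministic:
  it may return any feasible point and any lower bound that meet the gap requirement.\<close>

definition solve_steps ::
  "('n::finite, 'm::finite, 'l::finite, 'r::finite) two_stage \<Rightarrow> (real^'n \<Rightarrow> (real^'l) set)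
     \<Rightarrow> 'l iccg_state \<Rightarrow> real^'n \<Rightarrow> real^'l \<Rightarrow> 'l iccg_state \<Rightarrow> bool" where
  "solve_steps P orc s x \<xi> t \<longleftrightarrow>
     (\<exists>\<delta> L U. (x, \<delta>) \<in> master_set P (scen s) (L_bar s) \<and>
        U = c_vec P \<bullet> x + \<delta> \<and>
        L_bar s \<le> L \<and> ereal L \<le> master_value P (scen s) (L_bar s) \<and>
        U - L \<le> mp_tol s (idx s) * U \<and>
        \<xi> \<in> orc x \<and>
        t = s\<lparr>L_at := (L_at s)(idx s := L),
              U_at := (U_at s)(idx s := U),
              ell := (if L > L_bar s then idx s else ell s),
              L_bar := U,
              U_bar := min (U_bar s) (ereal (c_vec P \<bullet> x) + worst_recourse P x)\<rparr>)"

definition final_gap :: "('l::finite) iccg_state \<Rightarrow> ereal" where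
  "final_gap t = (U_bar t - ereal (L_at t (ell t))) / U_bar t"

definition current_gap :: "('l::finite) iccg_state \<Rightarrow> ereal" where
  "current_gap t = (U_bar t - ereal (U_at t (idx t))) / U_bar t"

datatype ('s, 'x) config = Running 's | Returned 'x

text \<open>One iteration is one pass from Step 1 until the algorithm returns or goes back to Step 1.\<close>

inductive iccg_iter ::
  "('n::finite, 'm::finite, 'l::finite, 'r::finite) two_stage \<Rightarrow> (real^'n \<Rightarrow> (real^'l) set)
     \<Rightarrow> real \<Rightarrow> real \<Rightarrow> real
     \<Rightarrow> ('l iccg_state, real^'n) config \<Rightarrow> ('l iccg_state, real^'n) config \<Rightarrow> bool"
  for P orc \<epsilon> \<epsilon>t \<alpha> where
  finish:
    "solve_steps P orc s x \<xi> t \<Longrightarrow> final_gap t < ereal \<epsilon>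
     \<Longrightarrow> iccg_iter P orc \<epsilon> \<epsilon>t \<alpha> (Running s) (Returned x)"
| exploitation:
    "solve_steps P orc s x \<xi> t \<Longrightarrow> \<not> final_gap t < ereal \<epsilon> \<Longrightarrow> current_gap t < ereal \<epsilon>t
     \<Longrightarrow> iccg_iter P orc \<epsilon> \<epsilon>t \<alpha> (Running s)
           (Running (t\<lparr>idx := ell t,
                       L_bar := L_at t (ell t),
                       mp_tol := (\<lambda>k. if ell t \<le> k then \<alpha> * mp_tol t k else mp_tol t k)\<rparr>))"
| exploration:
    "solve_steps P orc s x \<xi> t \<Longrightarrow> \<not> final_gap t < ereal \<epsilon> \<Longrightarrow> current_gap t \<ge> ereal \<epsilon>t
     \<Longrightarrow> iccg_iter P orc \<epsilon> \<epsilon>t \<alpha> (Running s)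
           (Running (t\<lparr>scen := insert \<xi> (scen t), idx := idx t + 1\<rparr>))"

text \<open>All executions are finite, and an execution that cannot be continued has returned
  (it did not get stuck because a subproblem has no admissible answer).\<close>

definition terminates :: "(('s, 'x) config \<Rightarrow> ('s, 'x) config \<Rightarrow> bool) \<Rightarrow> 's \<Rightarrow> bool" where
  "terminates step s \<longleftrightarrow>
     (\<nexists>\<sigma>. \<sigma> (0::nat) = Running s \<and> (\<forall>i. step (\<sigma> i) (\<sigma> (Suc i)))) \<and>
     (\<forall>t. step\<^sup>*\<^sup>* (Running s) t \<longrightarrow> (\<nexists>u. step t u) \<longrightarrow> (\<exists>x. t = Returned x))"

end

theory Submission
  imports Defs
begin

text \<open>Both gaps are measured against an upper bound \<open>B \<ge> K > 0\<close>. If the oracle returns a scenario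
  that is already in the scenario set, then \<open>B \<le> U\<^sup>j\<close>, so the current gap is nonpositive and no
  exploration takes place; hence every exploration adds a new element of the finite set of possible
  oracle answers. From an exploitation onwards, as long as no exploration occurs, \<open>j = \<ell>\<close> and the
  tolerance of the repeatedly solved master problem shrinks by the factor \<open>\<alpha>\<close> each time. An
  exploitation without termination, however, forces
  \<open>(1 - tol) (1 - \<epsilon>t) B \<le> L\<^sup>\<ell> \<le> (1 - \<epsilon>) B\<close>, which bounds the tolerance from below by
  \<open>(\<epsilon> - \<epsilon>t) / (1 - \<epsilon>t) > 0\<close>.\<close>

text \<open>As \<open>b \<le> c\<close>, the exponent 0 fails on the right, so the least exponent
  there is a successor; a factor \<open>a\<close> applied beforehand saves one step. The number of
  reductions still needed thus serves as a ranking for repeated exploitation.\<close>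

lemma Least_power_mult_less:
  fixes a b c :: real
  assumes "0 < a" "a < 1" "0 < b" "b \<le> c"
  shows "(LEAST n. a ^ n * (a * c) < b) < (LEAST n. a ^ n * c < b)"
proof -
  obtain n where "a ^ n < b / c"
    using real_arch_pow_inv[of "b / c" a] assms by auto
  then have "a ^ n * c < b"
    using assms by (simp add: field_simps)
  then have "(LEAST n. a ^ n * c < b) = Suc (LEAST m. a ^ Suc m * c < b)"
    using assms by (intro Least_Suc) auto
  then show ?thesis
    by (simp add: ac_simps)
qed

locale iccg =
  fixes P :: "('n::finite, 'm::finite, 'l::finite, 'r::finite) two_stage"
    and orc :: "real^'n \<Rightarrow> (real^'l) set"
    and K \<epsilon> \<epsilon>t \<alpha> :: real
  assumes unc_set: "finite (unc_set P) \<or> polytope (unc_set P)"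
    and fs_set_nonempty: "fs_set P \<noteq> {}"
    and second_stage_nonempty:
      "\<And>x \<xi>. x \<in> fs_set P \<Longrightarrow> \<xi> \<in> unc_set P \<Longrightarrow> second_stage_set P x \<xi> \<noteq> {}"
    and K_pos: "0 < K"
    and K_le: "\<And>x \<xi>. x \<in> fs_set P \<Longrightarrow> \<xi> \<in> unc_set P \<Longrightarrow>
      ereal K \<le> ereal (c_vec P \<bullet> x) + recourse P x \<xi>"
    and exact_oracle: "exact_oracle P orc"
    and \<epsilon>t_pos: "0 < \<epsilon>t" and \<epsilon>t_less: "\<epsilon>t < \<epsilon>" and \<epsilon>_le_1: "\<epsilon> \<le> 1"
    and \<alpha>_pos: "0 < \<alpha>" and \<alpha>_less_1: "\<alpha> < 1"
begin

section \<open>Finitely many oracle answers and finite recourse values\<close>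

definition answers :: "(real^'l) set" where
  "answers = (\<Union>x\<in>fs_set P. orc x)"

lemma answers_subset: "answers \<subseteq> unc_set P"
  using exact_oracle unfolding answers_def exact_oracle_def by blast

text \<open>On a polytope every answer is an extreme point, and there are finitely many of those;
  otherwise \<open>unc_set P\<close> itself is finite.\<close>

lemma finite_answers: "finite answers"
proof (cases "polytope (unc_set P)")
  case True
  then have "answers \<subseteq> {\<xi>. \<xi> extreme_point_of unc_set P}"
    using exact_oracle unfolding answers_def exact_oracle_def by blast
  then show ?thesis
    by (rule finite_subset)
      (intro finite_polyhedron_extreme_points polytope_imp_polyhedron True)
next
  case False
  then show ?thesis
    using unc_set answers_subset by (auto intro: finite_subset)
qed

text \<open>A feasible second-stage point excludes \<open>\<infinity>\<close>; the lower bound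
  \<open>K\<close> excludes \<open>-\<infinity>\<close>.\<close>

lemma recourse_real:
  assumes "x \<in> fs_set P" "\<xi> \<in> unc_set P"
  obtains r where "recourse P x \<xi> = ereal r" "K \<le> c_vec P \<bullet> x + r"
proof -
  obtain y where "y \<in> second_stage_set P x \<xi>"
    using second_stage_nonempty[OF assms] by blast
  then have "recourse P x \<xi> \<le> ereal (q_vec P \<bullet> y)"
    unfolding recourse_def by (rule INF_lower)
  then show thesis
    using K_le[OF assms] that by (cases "recourse P x \<xi>") auto
qed

section \<open>Invariant and the outcome of Steps 1 and 2\<close>

text \<open>The clause for \<open>ell s = 0\<close> serves to rule out backtracking to index 0,
  which has no master problem. \<open>0 \<le> L_at s (ell s)\<close> keeps \<open>L_bar\<close>
  nonnegative when backtracking resets it to that value.\<close>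

definition invar :: "'l iccg_state \<Rightarrow> bool" where
  "invar s \<longleftrightarrow> 1 \<le> idx s \<and> 0 \<le> L_bar s \<and> (ell s = 0 \<longrightarrow> L_bar s = 0) \<and>
     0 \<le> L_at s (ell s) \<and> scen s \<subseteq> answers \<and> ereal K \<le> U_bar s \<and>
     (\<forall>k\<ge>1. 0 < mp_tol s k \<and> mp_tol s k < 1)"

text \<open>The worst-case recourse equals \<open>recourse P x \<xi>\<close>, which is finite, so
  the new upper bound is a real \<open>B\<close> even if \<open>U_bar s\<close> is
  \<open>\<infinity>\<close>. If \<open>\<xi>\<close> is already a scenario, the master constraint
  bounds this recourse by \<open>\<delta>\<close>, whence \<open>B \<le> U\<close>.\<close>

lemma solve_stepsE:
  assumes "solve_steps P orc s x \<xi> t" "invar s"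
  obtains L U B where "\<xi> \<in> answers" "L_bar s \<le> L" "L_bar s \<le> U"
    "U - L \<le> mp_tol s (idx s) * U" "K \<le> B" "\<xi> \<in> scen s \<Longrightarrow> B \<le> U"
    "t = s\<lparr>L_at := (L_at s)(idx s := L), U_at := (U_at s)(idx s := U),
           ell := (if L > L_bar s then idx s else ell s), L_bar := U, U_bar := ereal B\<rparr>"
proof -
  from assms(1) obtain \<delta> L U where *: "x \<in> fs_set P" "\<forall>\<xi>\<in>scen s. recourse P x \<xi> \<le> ereal \<delta>"
    "L_bar s \<le> U" "U = c_vec P \<bullet> x + \<delta>" "L_bar s \<le> L"
    "U - L \<le> mp_tol s (idx s) * U" "\<xi> \<in> orc x"
    "t = s\<lparr>L_at := (L_at s)(idx s := L), U_at := (U_at s)(idx s := U),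
           ell := (if L > L_bar s then idx s else ell s), L_bar := U,
           U_bar := min (U_bar s) (ereal (c_vec P \<bullet> x) + worst_recourse P x)\<rparr>"
    unfolding solve_steps_def master_set_def by auto
  have \<xi>: "\<xi> \<in> answers" "worst_recourse P x = recourse P x \<xi>"
    using * exact_oracle unfolding answers_def exact_oracle_def by auto
  then obtain r where r: "recourse P x \<xi> = ereal r" "K \<le> c_vec P \<bullet> x + r"
    using recourse_real * answers_subset by blast
  have "ereal K \<le> U_bar s"
    using assms(2) by (simp add: invar_def)
  then obtain B where B:
    "min (U_bar s) (ereal (c_vec P \<bullet> x) + worst_recourse P x) = ereal B"
    "K \<le> B" "B \<le> c_vec P \<bullet> x + r"
  proof (cases "U_bar s")
    case (real u)
    then show thesis
      using that[of "min u (c_vec P \<bullet> x + r)"] \<xi>(2) r \<open>ereal K \<le> U_bar s\<close>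
      by (simp add: min_def)
  next
    case PInf
    then show thesis
      using that[of "c_vec P \<bullet> x + r"] \<xi>(2) r by simp
  qed simp
  have "B \<le> U" if "\<xi> \<in> scen s"
  proof -
    have "recourse P x \<xi> \<le> ereal \<delta>"
      using *(2) that by blast
    then show ?thesis
      using *(4) r(1) B(3) by simp
  qed
  then show thesis
    using that[of L U B] *(3,5,6,8) \<xi>(1) B(1,2) by simp
qed

lemma init_invar:
  assumes "\<And>j. j \<ge> 1 \<Longrightarrow> 0 < tol j \<and> tol j < 1"
  shows "invar (iccg_init tol)"
  using assms by (simp add: invar_def iccg_init_def)

section \<open>Tolerance threshold and progress measure\<close>

definition tol_threshold :: real where
  "tol_threshold = (\<epsilon> - \<epsilon>t) / (1 - \<epsilon>t)"

lemma tol_threshold_pos: "0 < tol_threshold"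
  using \<epsilon>t_less \<epsilon>_le_1 by (simp add: tol_threshold_def)

lemma tol_threshold_le:
  fixes B L U \<tau> :: real
  assumes B: "0 < B" and gap: "\<not> (B - L) / B < \<epsilon>" "(B - U) / B < \<epsilon>t"
    and L: "U - L \<le> \<tau> * U" and \<tau>: "\<tau> < 1"
  shows "tol_threshold \<le> \<tau>"
proof -
  have "L \<le> (1 - \<epsilon>) * B" "(1 - \<epsilon>t) * B \<le> U"
    using B gap by (simp_all add: field_simps)
  \<comment> \<open>The gap requirement reads \<open>(1 - \<tau>) * U \<le> L\<close>, which links
    the two bounds just obtained.\<close>
  then have "(1 - \<tau>) * ((1 - \<epsilon>t) * B) \<le> (1 - \<epsilon>) * B"
    using \<tau> L mult_left_mono[of "(1 - \<epsilon>t) * B" U "1 - \<tau>"] by (simp add: algebra_simps)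
  then have "((1 - \<tau>) * (1 - \<epsilon>t)) * B \<le> (1 - \<epsilon>) * B"
    by (simp add: mult.assoc)
  then have "(1 - \<tau>) * (1 - \<epsilon>t) \<le> 1 - \<epsilon>"
    using B by (simp only: mult_le_cancel_right_pos)
  then have "\<epsilon> - \<epsilon>t \<le> \<tau> * (1 - \<epsilon>t)"
    by (simp add: algebra_simps)
  then show ?thesis
    using \<epsilon>t_less \<epsilon>_le_1 by (simp add: tol_threshold_def pos_divide_le_eq)
qed

text \<open>Exploration lowers the first entry. Exploitation keeps it and makes \<open>idx\<close>
  equal to \<open>ell\<close>: if they differed, the second entry drops; if not, the index stays,
  its tolerance gains a factor \<open>\<alpha>\<close>, and the third entry drops.\<close>

definition progress :: "('l iccg_state \<times> 'l iccg_state) set" where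
  "progress = measures
     [\<lambda>s. card (answers - scen s),
      \<lambda>s. if idx s = ell s then 0 else 1,
      \<lambda>s. LEAST n. \<alpha> ^ n * mp_tol s (idx s) < tol_threshold]"

lemma iccg_iter_progress:
  assumes "iccg_iter P orc \<epsilon> \<epsilon>t \<alpha> (Running s) (Running s')" "invar s"
  shows "invar s' \<and> (s', s) \<in> progress"
  using assms(1)
proof cases
  case (exploitation x \<xi> t)
  obtain L U B where \<xi>: "\<xi> \<in> answers"
    and LUB: "L_bar s \<le> L" "L_bar s \<le> U" "U - L \<le> mp_tol s (idx s) * U" "K \<le> B"
    and B_le: "\<xi> \<in> scen s \<Longrightarrow> B \<le> U"
    and t: "t = s\<lparr>L_at := (L_at s)(idx s := L), U_at := (U_at s)(idx s := U),
           ell := (if L > L_bar s then idx s else ell s), L_bar := U, U_bar := ereal B\<rparr>"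
    by (rule solve_stepsE[OF exploitation(2) assms(2)]) (rule that)
  have B: "0 < B"
    using LUB K_pos by simp
  have tol: "0 < mp_tol s k" "mp_tol s k < 1" if "1 \<le> k" for k
    using assms(2) that by (auto simp: invar_def)
  have s: "1 \<le> idx s" "0 \<le> L_bar s" "ell s = 0 \<longrightarrow> L_bar s = 0" "0 \<le> L_at s (ell s)"
    using assms(2) by (auto simp: invar_def)
  have gap: "\<not> (B - L_at t (ell t)) / B < \<epsilon>" "(B - U) / B < \<epsilon>t"
    using exploitation(3,4) B by (simp_all add: final_gap_def current_gap_def t)
  \<comment> \<open>Otherwise no lower bound has improved on \<open>L_bar s = 0\<close>, so
    \<open>L = 0\<close>, and a tolerance below 1 forces \<open>U = 0\<close>. The current gap is
    then 1, too large for exploitation.\<close>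
  have "ell t \<noteq> 0"
  proof
    assume "ell t = 0"
    then have "L = 0" "0 \<le> U"
      using s LUB by (auto simp: t split: if_splits)
    then have "U \<le> 0"
      using LUB(3) tol[OF s(1)] mult_le_cancel_right1[of U "mp_tol s (idx s)"] by force
    then have "1 < \<epsilon>t"
      using gap(2) B \<open>0 \<le> U\<close> by simp
    then show False
      using \<epsilon>t_less \<epsilon>_le_1 by simp
  qed
  moreover have "0 \<le> L_at t (ell t)"
    using s LUB by (auto simp: t)
  moreover have "0 < \<alpha> * mp_tol s k \<and> \<alpha> * mp_tol s k < 1" if "1 \<le> k" for k
    using tol[OF that] \<alpha>_pos \<alpha>_less_1 mult_strict_mono[of \<alpha> 1 "mp_tol s k" 1] by simp
  ultimately have "invar s'"
    using assms(2) LUB(4) tol by (simp add: invar_def exploitation(1)) (simp add: t)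
  moreover have "(s', s) \<in> progress"
  proof (cases "idx s = ell s")
    case True
    \<comment> \<open>Both branches of the update of \<open>ell\<close> agree here. The final gap
      therefore uses the bound \<open>L\<close> just computed, as the threshold estimate
      requires.\<close>
    then have ell: "ell t = idx s"
      by (simp add: t)
    then have "tol_threshold \<le> mp_tol s (idx s)"
      using tol_threshold_le[OF B gap(1)[unfolded ell] gap(2)] LUB(3) tol[OF s(1)]
      by (simp add: t)
    then show ?thesis
      using True ell Least_power_mult_less[OF \<alpha>_pos \<alpha>_less_1 tol_threshold_pos] exploitation(1)
      by (simp add: progress_def t)
  next
    case False
    then show ?thesis
      using exploitation(1) by (simp add: progress_def t)
  qed
  ultimately show ?thesis ..
next
  case (exploration x \<xi> t)
  obtain L U B where \<xi>: "\<xi> \<in> answers"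
    and LUB: "L_bar s \<le> L" "L_bar s \<le> U" "U - L \<le> mp_tol s (idx s) * U" "K \<le> B"
    and B_le: "\<xi> \<in> scen s \<Longrightarrow> B \<le> U"
    and t: "t = s\<lparr>L_at := (L_at s)(idx s := L), U_at := (U_at s)(idx s := U),
           ell := (if L > L_bar s then idx s else ell s), L_bar := U, U_bar := ereal B\<rparr>"
    by (rule solve_stepsE[OF exploration(2) assms(2)]) (rule that)
  have B: "0 < B"
    using LUB K_pos by simp
  have s: "1 \<le> idx s" "0 \<le> L_bar s" "ell s = 0 \<longrightarrow> L_bar s = 0" "mp_tol s (idx s) < 1"
    using assms(2) by (auto simp: invar_def)
  have "\<epsilon>t \<le> (B - U) / B"
    using exploration(4) B by (simp add: current_gap_def t)
  then have "U < B"
    using B \<epsilon>t_pos by (simp add: field_simps) (smt (verit) mult_pos_pos)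
  then have "answers - scen s' \<subset> answers - scen s"
    using \<xi> B_le exploration(1) by (auto simp: t)
  then have "(s', s) \<in> progress"
    using finite_answers by (simp add: progress_def psubset_card_mono)
  \<comment> \<open>Exploration leaves \<open>L_bar\<close> at \<open>U\<close>, so this preserves
    the clause of the invariant for \<open>ell = 0\<close>.\<close>
  moreover have "U = 0" if "ell t = 0"
  proof -
    have "L = 0"
      using that s LUB by (auto simp: t split: if_splits)
    then show ?thesis
      using LUB(2,3) s mult_le_cancel_right1[of U "mp_tol s (idx s)"] by force
  qed
  then have "invar s'"
    using assms(2) exploration(1) LUB \<xi> by (auto simp: invar_def t)
  ultimately show ?thesis
    by blast
qed

section \<open>Absence of deadlock\<close>

text \<open>The master infimum need not be attained, but a positive relative tolerance admits a
  near-optimal point when the value is positive. Without scenarios the value may be 0, hence the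
  separate case.\<close>

lemma solve_steps_exists:
  assumes "invar s"
  shows "\<exists>x \<xi> t. solve_steps P orc s x \<xi> t"
proof -
  have s: "0 \<le> L_bar s" "scen s \<subseteq> answers" "0 < mp_tol s (idx s)" "mp_tol s (idx s) < 1"
    using assms by (auto simp: invar_def)
  let ?M = "master_set P (scen s) (L_bar s)" and ?v = "master_value P (scen s) (L_bar s)"
  let ?\<tau> = "mp_tol s (idx s)"
  have L_bar_le: "ereal (L_bar s) \<le> ?v"
    unfolding master_value_def by (rule INF_greatest) (auto simp: master_set_def)
  have "\<exists>x \<delta> L. (x, \<delta>) \<in> ?M \<and> L_bar s \<le> L \<and> ereal L \<le> ?v \<and>
      c_vec P \<bullet> x + \<delta> - L \<le> ?\<tau> * (c_vec P \<bullet> x + \<delta>)"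
  proof (cases "scen s = {}")
    case True
    obtain x where "x \<in> fs_set P"
      using fs_set_nonempty by blast
    \<comment> \<open>With \<open>\<delta>\<close> otherwise unconstrained, the objective can equal
      \<open>L_bar s\<close> exactly, which closes the gap.\<close>
    then have "(x, L_bar s - c_vec P \<bullet> x) \<in> ?M"
      using True by (simp add: master_set_def)
    then show ?thesis
      using L_bar_le s by (intro exI[of _ x] exI[of _ "L_bar s - c_vec P \<bullet> x"] exI[of _ "L_bar s"]) simp
  next
    case False
    then obtain \<xi> where \<xi>: "\<xi> \<in> scen s"
      by blast
    have "ereal K \<le> ereal (c_vec P \<bullet> x + \<delta>)" if "(x, \<delta>) \<in> ?M" for x \<delta>
    proof -
      have "x \<in> fs_set P" "recourse P x \<xi> \<le> ereal \<delta>"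
        using that \<xi> by (auto simp: master_set_def)
      then show ?thesis
        using recourse_real[of x \<xi>] \<xi> s(2) answers_subset by force
    qed
    then have K_le_v: "ereal K \<le> ?v"
      unfolding master_value_def by (auto intro!: INF_greatest)
    obtain x where x: "x \<in> fs_set P"
      using fs_set_nonempty by blast
    have "\<forall>\<xi>\<in>scen s. \<exists>r. recourse P x \<xi> = ereal r"
      using recourse_real[OF x] s(2) answers_subset by blast
    then obtain r where r: "\<And>\<xi>. \<xi> \<in> scen s \<Longrightarrow> recourse P x \<xi> = ereal (r \<xi>)"
      by metis
    \<comment> \<open>The least value of \<open>\<delta>\<close> that meets all master constraints
      at \<open>x\<close>.\<close>
    define \<delta> where "\<delta> = Max (insert (L_bar s - c_vec P \<bullet> x) (r ` scen s))"
    have "finite (scen s)"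
      using s(2) finite_answers finite_subset by blast
    then have "L_bar s - c_vec P \<bullet> x \<le> \<delta>" "\<And>\<xi>. \<xi> \<in> scen s \<Longrightarrow> r \<xi> \<le> \<delta>"
      by (auto simp: \<delta>_def intro: Max_ge)
    then have "(x, \<delta>) \<in> ?M"
      using x r by (auto simp: master_set_def)
    then have "?v \<le> ereal (c_vec P \<bullet> x + \<delta>)"
      unfolding master_value_def by (auto intro: INF_lower2)
    then obtain v where v: "?v = ereal v"
      using K_le_v by (cases ?v) auto
    have "0 < v"
      using K_le_v K_pos v by simp
    \<comment> \<open>For the lower bound \<open>v\<close>, an objective value \<open>U\<close>
      meets the gap requirement iff \<open>U \<le> v / (1 - ?\<tau>)\<close>.\<close>
    then have "v < v / (1 - ?\<tau>)"
      using s by (simp add: field_simps)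
    then have "?v < ereal (v / (1 - ?\<tau>))"
      using v by simp
    then obtain x' \<delta>' where *: "(x', \<delta>') \<in> ?M" "c_vec P \<bullet> x' + \<delta>' < v / (1 - ?\<tau>)"
      unfolding master_value_def INF_less_iff by auto
    then have "c_vec P \<bullet> x' + \<delta>' - v \<le> ?\<tau> * (c_vec P \<bullet> x' + \<delta>')"
      using s by (simp add: field_simps)
    then show ?thesis
      using * v L_bar_le by (intro exI[of _ x'] exI[of _ \<delta>'] exI[of _ v]) simp
  qed
  then obtain x \<delta> L where *: "(x, \<delta>) \<in> ?M" "L_bar s \<le> L" "ereal L \<le> ?v"
    "c_vec P \<bullet> x + \<delta> - L \<le> ?\<tau> * (c_vec P \<bullet> x + \<delta>)"
    by blast
  then have "orc x \<noteq> {}"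
    using exact_oracle by (auto simp: exact_oracle_def master_set_def)
  then show ?thesis
    using * unfolding solve_steps_def by blast
qed

lemma iccg_iter_exists:
  assumes "invar s"
  shows "\<exists>u. iccg_iter P orc \<epsilon> \<epsilon>t \<alpha> (Running s) u"
proof -
  obtain x \<xi> t where t: "solve_steps P orc s x \<xi> t"
    using solve_steps_exists[OF assms] by blast
  consider "final_gap t < ereal \<epsilon>" | "\<not> final_gap t < ereal \<epsilon>" "current_gap t < ereal \<epsilon>t"
    | "\<not> final_gap t < ereal \<epsilon>" "ereal \<epsilon>t \<le> current_gap t"
    using not_le by blast
  then show ?thesis
    by cases (use t in \<open>blast intro: iccg_iter.intros\<close>)+
qed

section \<open>Termination\<close>

theorem terminates_if_invar:
  assumes "invar s"
  shows "terminates (iccg_iter P orc \<epsilon> \<epsilon>t \<alpha>) s"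
  unfolding terminates_def
proof (intro conjI allI impI notI)
  let ?step = "iccg_iter P orc \<epsilon> \<epsilon>t \<alpha>"
  assume "\<exists>\<sigma>. \<sigma> (0::nat) = Running s \<and> (\<forall>i. ?step (\<sigma> i) (\<sigma> (Suc i)))"
  then obtain \<sigma> where \<sigma>: "\<sigma> (0::nat) = Running s" "\<And>i. ?step (\<sigma> i) (\<sigma> (Suc i))"
    by blast
  \<comment> \<open>A returned configuration has no successor.\<close>
  have "\<exists>s. \<sigma> i = Running s" for i
    using \<sigma>(2)[of i] by cases auto
  then obtain f where f: "\<And>i. \<sigma> i = Running (f i)"
    by metis
  have "invar (f i)" for i
  proof (induction i)
    case 0
    then show ?case
      using assms \<sigma>(1) f[of 0] by simp
  next
    case (Suc i)
    then show ?case
      using iccg_iter_progress \<sigma>(2)[of i] f by metis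
  qed
  then have "\<forall>i. (f (Suc i), f i) \<in> progress"
    using iccg_iter_progress \<sigma>(2) f by metis
  moreover have "wf progress"
    by (simp add: progress_def)
  ultimately show False
    by (auto simp: wf_iff_no_infinite_down_chain)
next
  let ?step = "iccg_iter P orc \<epsilon> \<epsilon>t \<alpha>"
  fix t
  assume reach: "?step\<^sup>*\<^sup>* (Running s) t" and stuck: "\<nexists>u. ?step t u"
  from reach have "\<forall>s'. t = Running s' \<longrightarrow> invar s'"
  proof (induction rule: rtranclp_induct)
    case base
    then show ?case
      using assms by simp
  next
    case (step y z)
    from step(2) obtain s' where "y = Running s'"
      by cases auto
    then show ?case
      using step iccg_iter_progress by blast
  qed
  then show "\<exists>x. t = Returned x"
    using stuck iccg_iter_exists by (cases t) auto
qed

end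

theorem theorem4:
  fixes P :: "('n::finite, 'm::finite, 'l::finite, 'r::finite) two_stage"
    and orc :: "real^'n \<Rightarrow> (real^'l) set"
    and xstar :: "real^'n" and vstar K \<epsilon> \<epsilon>t \<alpha> :: real
    and \<epsilon>MP :: "nat \<Rightarrow> real"
  assumes "(finite (unc_set P) \<and> unc_set P \<noteq> {}) \<or> polytope (unc_set P)"
    and "\<And>x \<xi>. x \<in> fs_set P \<Longrightarrow> \<xi> \<in> unc_set P \<Longrightarrow> second_stage_set P x \<xi> \<noteq> {}"
    and "robust_optimal P xstar (ereal vstar)"
    and "K > 0"
    and "\<And>x \<xi>. x \<in> fs_set P \<Longrightarrow> \<xi> \<in> unc_set P \<Longrightarrow> ereal (c_vec P \<bullet> x) + recourse P x \<xi> \<ge> ereal K"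
    and "exact_oracle P orc"
    and "0 \<le> \<epsilon>" and "\<epsilon> \<le> 1"
    and "0 < \<epsilon>t" and "\<epsilon>t < \<epsilon> / (1 + \<epsilon>)"
    and "\<And>j. j \<ge> 1 \<Longrightarrow> 0 < \<epsilon>MP j \<and> \<epsilon>MP j < 1"
    and "0 < \<alpha>" and "\<alpha> < 1"
  shows "terminates (iccg_iter P orc \<epsilon> \<epsilon>t \<alpha>) (iccg_init \<epsilon>MP)"
proof -
  have "\<epsilon> / (1 + \<epsilon>) \<le> \<epsilon>"
    using \<open>0 \<le> \<epsilon>\<close> by (simp add: field_simps)
  then have "\<epsilon>t < \<epsilon>"
    using \<open>\<epsilon>t < \<epsilon> / (1 + \<epsilon>)\<close> by linarith
  moreover have "fs_set P \<noteq> {}"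
    using assms(3) by (auto simp: robust_optimal_def)
  ultimately interpret iccg P orc K \<epsilon> \<epsilon>t \<alpha>
    using assms by unfold_locales auto
  show ?thesis
    using assms(11) by (intro terminates_if_invar init_invar)
qed

end
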